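(* Let $m_1 < m_2 < \cdots < m_s$ be pairwise coprime integers $\ge 2$, let $x_1,\ldots,x_s \in \mathbb{Z}$, let $P,Q$ be positive integers, and let $0 \le e \le s$ be an integer. Put $M = m_1 m_2\cdots m_s$ and $M_{\mathrm{max}} = m_{s-e+1} m_{s-e+2}\cdots m_s$ (the product of the $e$ largest moduli, equal to $1$ if $e=0$), and assume $M > 2 P Q M_{\mathrm{max}}^2$. Then there is at most one valid rational for these data. If a valid rational exists, then Algorithm FTRR on input $e$, $P$, $Q$, $\{x_i \bmod m_i : i=1,\ldots,s\}$ terminates and returns it; if no valid rational exists, then Algorithm FTRR terminates and returns FAILURE.
   Context: A rational written $p/q$ is normalized if $q>0$ and $\gcd(p,q)=1$. For a normalized rational $p/q$, the modulus $m_i$ is good if $q x_i \equiv p \pmod{m_i}$, and bad otherwise. A valid rational is a normalized rational $p/q$ with $|p| \le P$, $1 \le q \le Q$ and at most $e$ bad moduli among $m_1,\ldots,m_s$. Algorithm FTRR (for a triple $u\in\mathbb{Z}^3$, write $u=(u_1,u_2,u_3)$, and similarly for $v$): 1. Input $e$, $P$, $Q$ and $\{x_i \bmod m_i : i=1,\ldots,s\}$. 2. If $x_i \equiv 0 \pmod{m_i}$ for at least $s-e$ indices $i$, then return $0$. 3. Set $M=\prod_i m_i$. Compute an integer $X$ satisfying $X \equiv x_i \pmod{m_i}$ for each $i$ (via Chinese remaindering). 4. Compute $M_{\mathrm{max}} = m_{s-e+1} m_{s-e+2}\cdots m_s$. 5. If $\gcd(X,M) > P M_{\mathrm{max}}$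 then return FAILURE. 6. Put $u=(1,0,M)$ and $v=(0,1,X)$. 7. While $|v_2| \le Q M_{\mathrm{max}}$ do: set $q=\lfloor u_3/v_3\rfloor$; replace $u$ by $u-qv$; then swap $u$ and $v$. 8. Set $r = X + M\cdot \frac{u_1}{u_2}$ as a normalized rational. 9. Check whether $r$ is a valid rational, i.e. the absolute value of its numerator is $\le P$, its denominator is $\le Q$, and it has at most $e$ bad moduli. 10. If $r$ is valid, return $r$; otherwise return FAILURE.
   Formalization: In step 3 the integer X computed by Chinese remaindering is required to be non-negative; for negative X the claim fails (e.g. s=1, m=3, x=1, P=Q=1, e=0, X=-2 gives FAILURE although 1/1 is valid). *)

theory Defs
  imports Complex_Main "HOL-Number_Theory.Cong"
begin

text \<open>
  The moduli \<open>m 1, \<dots>, m s\<close> and residues \<open>x 1, \<dots>, x s\<close> are given by functions on \<open>nat\<close>, of which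
  only the values at \<open>{1..s}\<close> matter. A rational number is identified with its normalized
  representation, which is \<open>quotient_of\<close>.
\<close>

definition good :: "(nat \<Rightarrow> int) \<Rightarrow> (nat \<Rightarrow> int) \<Rightarrow> rat \<Rightarrow> nat \<Rightarrow> bool" where
  "good m x r i \<longleftrightarrow> (case quotient_of r of (p, q) \<Rightarrow> [q * x i = p] (mod m i))"

definition valid_rational ::
  "nat \<Rightarrow> (nat \<Rightarrow> int) \<Rightarrow> nat \<Rightarrow> int \<Rightarrow> int \<Rightarrow> (nat \<Rightarrow> int) \<Rightarrow> rat \<Rightarrow> bool" where
  "valid_rational s m e P Q x r \<longleftrightarrow>
     (case quotient_of r of (p, q) \<Rightarrow> \<bar>p\<bar> \<le> P \<and> 1 \<le> q \<and> q \<le> Q) \<and>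
     card {i \<in> {1..s}. \<not> good m x r i} \<le> e"

definition M_total :: "nat \<Rightarrow> (nat \<Rightarrow> int) \<Rightarrow> int" where
  "M_total s m = (\<Prod>i = 1..s. m i)"

definition M_max :: "nat \<Rightarrow> (nat \<Rightarrow> int) \<Rightarrow> nat \<Rightarrow> int" where
  "M_max s m e = (\<Prod>i = s - e + 1..s. m i)"

text \<open>
  The loop, with bound \<open>B\<close> on \<open>\<bar>v2\<bar>\<close>; it yields the final \<open>u\<close>. The value \<open>None\<close> means that the
  loop runs forever or divides by zero. On \<open>int\<close>, \<open>div\<close> is the floor of the quotient.
\<close>

partial_function (option) ftrr_loop ::
  "int \<Rightarrow> int \<times> int \<times> int \<Rightarrow> int \<times> int \<times> int \<Rightarrow> (int \<times> int \<times> int) option" where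
  "ftrr_loop B u v =
     (case u of (u1, u2, u3) \<Rightarrow> case v of (v1, v2, v3) \<Rightarrow>
        if \<bar>v2\<bar> \<le> B then
          if v3 = 0 then None
          else let q = u3 div v3 in
            ftrr_loop B (v1, v2, v3) (u1 - q * v1, u2 - q * v2, u3 - q * v3)
        else Some (u1, u2, u3))"

datatype outcome = Failure | Return rat

text \<open>
  The run of the algorithm in which Chinese remaindering produces \<open>X\<close>. The value \<open>None\<close> means
  that the run does not terminate or divides by zero (in the loop or in forming \<open>u1 / u2\<close>).
\<close>

definition ftrr_run ::
  "nat \<Rightarrow> (nat \<Rightarrow> int) \<Rightarrow> nat \<Rightarrow> int \<Rightarrow> int \<Rightarrow> (nat \<Rightarrow> int) \<Rightarrow> int \<Rightarrow> outcome option" where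
  "ftrr_run s m e P Q x X =
     (if card {i \<in> {1..s}. [x i = 0] (mod m i)} \<ge> s - e then Some (Return 0)
      else let M = M_total s m; Mmax = M_max s m e in
        if gcd X M > P * Mmax then Some Failure
        else case ftrr_loop (Q * Mmax) (1, 0, M) (0, 1, X) of
            None \<Rightarrow> None
          | Some (u1, u2, u3) \<Rightarrow>
              if u2 = 0 then None
              else let r = of_int X + of_int M * (of_int u1 / of_int u2) in
                if valid_rational s m e P Q x r then Some (Return r) else Some Failure)"

text \<open>
  The possible results of Chinese remaindering. Any non-negative solution is allowed, reduced
  modulo \<open>M\<close> or not. Non-negativity cannot be dropped: for the single modulus \<open>3\<close>, residue \<open>1\<close>,
  \<open>P = Q = 1\<close>, \<open>e = 0\<close>, the solution \<open>X = -2\<close> makes the algorithm fail, while \<open>1/1\<close> is valid.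
\<close>

definition crt_solution :: "nat \<Rightarrow> (nat \<Rightarrow> int) \<Rightarrow> (nat \<Rightarrow> int) \<Rightarrow> int \<Rightarrow> bool" where
  "crt_solution s m x X \<longleftrightarrow> 0 \<le> X \<and> (\<forall>i\<in>{1..s}. [X = x i] (mod m i))"

text \<open>
  Total correctness over all choices of \<open>X\<close>: a choice exists, and with each choice the algorithm
  terminates with outcome \<open>res\<close>.
\<close>

definition ftrr_terminates_with ::
  "nat \<Rightarrow> (nat \<Rightarrow> int) \<Rightarrow> nat \<Rightarrow> int \<Rightarrow> int \<Rightarrow> (nat \<Rightarrow> int) \<Rightarrow> outcome \<Rightarrow> bool" where
  "ftrr_terminates_with s m e P Q x res \<longleftrightarrow>
     (\<exists>X. crt_solution s m x X) \<and>
     (\<forall>X. crt_solution s m x X \<longrightarrow> ftrr_run s m e P Q x X = Some res)"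

end

theory Submission
  imports Defs
begin

text \<open>
  The rationals occurring in the proof are controlled by one congruence. Let \<open>X\<close> solve the system
  of congruences, let \<open>p/q\<close> be valid, and let \<open>d\<close> be the product of its bad moduli. Then
  \<open>d \<le> Mmax\<close>, and multiplying by \<open>d\<close> repairs the bad moduli: \<open>d q X \<equiv> d p\<close> modulo all of \<open>M\<close>
  (\<open>valid_rational_lift\<close>). So \<open>(d p)/(d q)\<close> solves an error-free rational reconstruction problem
  modulo \<open>M\<close> with the larger bounds \<open>A = P Mmax\<close> on the numerator and \<open>B = Q Mmax\<close> on the
  denominator, and the hypothesis on \<open>M\<close> says exactly that \<open>2 A B < M\<close>.

  Uniqueness is then immediate: for two valid rationals, \<open>M\<close> divides \<open>d d' (p q' - p' q)\<close>, whose
  absolute value is at most \<open>2 A B\<close>. Also \<open>gcd(X, M)\<close> divides \<open>d p\<close>, which explains the gcd test: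
  a valid \<open>p/q \<noteq> 0\<close> forces \<open>gcd(X, M) \<le> A\<close>. The rational \<open>0\<close> is valid precisely when the
  first test of the algorithm succeeds.

  The loop is the Euclidean algorithm. Its triples satisfy \<open>u3 = u1 M + u2 X\<close>, the determinant
  \<open>u2 v3 - v2 u3\<close> is \<open>M\<close> up to sign, and the signs of \<open>u2, v2\<close> alternate, so that
  \<open>\<bar>u2\<bar> v3 + \<bar>v2\<bar> u3 = M\<close>. The remainder \<open>v3\<close> cannot reach \<open>0\<close> while \<open>\<bar>v2\<bar> \<le> B\<close>, because then
  \<open>u3 = gcd(X, M) \<le> A\<close> and \<open>M \<le> A B\<close>; hence the loop ends (\<open>ftrr_loop_terminates\<close>). At
  that point \<open>X + M u1/u2 = u3/u2\<close>. A minimality argument for consecutive Euclidean remainders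
  shows that \<open>(d p)/(d q)\<close> equals \<open>u3/u2\<close> (\<open>convergent_unique\<close>), so that a valid rational, if there
  is one, is the rational that the algorithm checks.
\<close>

section \<open>Clearing the bad moduli\<close>

text \<open>
  Removing the largest index from the set (or any index, if the largest is absent) leaves a subset
  of \<open>{1..s}\<close> while \<open>m (Suc s)\<close> bounds the removed factor; this drives the induction.
\<close>

lemma prod_le_prod_largest:
  fixes m :: "nat \<Rightarrow> int"
  assumes "mono_on {1..s} m" "\<forall>i\<in>{1..s}. m i \<ge> 1"
    and "S \<subseteq> {1..s}" "card S \<le> e" "e \<le> s"
  shows "prod m S \<le> (\<Prod>i = s - e + 1..s. m i)"
  using assms
proof (induction s arbitrary: S e)
  case 0
  then show ?case by simp
next
  case (Suc s)
  show ?case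
  proof (cases "S = {}")
    case True
    have "1 \<le> (\<Prod>i = Suc s - e + 1..Suc s. m i)"
      using Suc.prems(2) by (intro prod_ge_1) auto
    with True show ?thesis by simp
  next
    case False
    define b where "b = (if Suc s \<in> S then Suc s else (SOME b. b \<in> S))"
    have b: "b \<in> S"
      using False by (auto simp: b_def some_in_eq)
    have fin: "finite S"
      using Suc.prems(3) finite_subset by blast
    have sub: "S - {b} \<subseteq> {1..s}"
      using Suc.prems(3) by (auto simp: b_def le_Suc_eq)
    have "card S > 0"
      using b fin card_gt_0_iff by blast
    then obtain e' where e': "e = Suc e'"
      using Suc.prems(4) by (cases e) auto
    have "card (S - {b}) \<le> e'"
      using Suc.prems(4) b fin e' by simp
    then have IH: "prod m (S - {b}) \<le> (\<Prod>i = s - e' + 1..s. m i)"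
      using Suc.prems e' sub by (intro Suc.IH) (auto intro: mono_on_subset)
    have mb: "m b \<le> m (Suc s)"
      using Suc.prems(1,3) b by (auto simp: mono_on_def)
    have "prod m S = m b * prod m (S - {b})"
      using b fin by (simp add: prod.remove)
    also have "\<dots> \<le> m (Suc s) * (\<Prod>i = s - e' + 1..s. m i)"
    proof (rule mult_mono[OF mb IH])
      show "0 \<le> m (Suc s)"
        using Suc.prems(2) by (auto intro: order_trans[of 0 1])
      show "0 \<le> prod m (S - {b})"
        using Suc.prems(2,3) by (intro prod_nonneg) fastforce
    qed
    also have "\<dots> = (\<Prod>i = Suc s - e + 1..Suc s. m i)"
      using e' by (simp add: prod.nat_ivl_Suc' mult.commute)
    finally show ?thesis .
  qed
qed

lemma valid_rational_lift:
  assumes "strict_mono_on {1..s} m" "\<forall>i\<in>{1..s}. m i \<ge> 2"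
    and cop: "pairwise (\<lambda>i j. coprime (m i) (m j)) {1..s}"
    and "e \<le> s"
    and X: "crt_solution s m x X"
    and valid: "valid_rational s m e P Q x r"
  obtains p q d where "quotient_of r = (p, q)" "\<bar>p\<bar> \<le> P" "1 \<le> q" "q \<le> Q"
    "1 \<le> d" "d \<le> M_max s m e" "M_total s m dvd d * (q * X - p)"
proof -
  obtain p q where pq: "quotient_of r = (p, q)"
    by (cases "quotient_of r") auto
  define S where "S = {i \<in> {1..s}. \<not> good m x r i}"
  have S: "S \<subseteq> {1..s}" by (auto simp: S_def)
  have bounds: "\<bar>p\<bar> \<le> P" "1 \<le> q" "q \<le> Q" "card S \<le> e"
    using valid pq by (auto simp: valid_rational_def S_def)
  have "1 \<le> prod m S"
    using S assms(2) by (intro prod_ge_1) force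
  moreover have "prod m S \<le> M_max s m e"
    unfolding M_max_def using assms S bounds
    by (intro prod_le_prod_largest) (auto intro: strict_mono_on_imp_mono_on)
  moreover have "M_total s m dvd prod m S * (q * X - p)"
  proof -
    have "[q * X = p] (mod m i)" if "i \<in> {1..s} - S" for i
    proof -
      have "[q * X = q * x i] (mod m i)"
        using X that by (intro cong_scalar_left) (auto simp: crt_solution_def)
      also have "[q * x i = p] (mod m i)"
        using that pq by (auto simp: S_def good_def)
      finally show ?thesis .
    qed
    moreover have "\<forall>i\<in>{1..s} - S. \<forall>j\<in>{1..s} - S. i \<noteq> j \<longrightarrow> coprime (m i) (m j)"
      using cop by (auto simp: pairwise_def)
    ultimately have "[q * X = p] (mod prod m ({1..s} - S))"
      by (intro cong_cong_prod_coprime) auto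
    moreover have "M_total s m = prod m S * prod m ({1..s} - S)"
      unfolding M_total_def using S by (simp add: prod.subset_diff mult.commute)
    ultimately show ?thesis
      by (simp add: cong_iff_dvd_diff mult_dvd_mono)
  qed
  ultimately show ?thesis
    using that pq bounds by blast
qed

lemma crt_solution_exists:
  assumes "\<forall>i\<in>{1..s}. m i > 0"
    and "pairwise (\<lambda>i j. coprime (m i) (m j)) {1..s}"
  shows "\<exists>X. crt_solution s m (\<lambda>i. x i mod m i) X"
proof -
  have "coprime (nat (m i)) (nat (m j))" if "i \<in> {1..s}" "j \<in> {1..s}" "i \<noteq> j" for i j
  proof -
    have "coprime (int (nat (m i))) (int (nat (m j)))"
      using that assms by (auto simp: pairwise_def less_imp_le)
    then show ?thesis by (simp only: coprime_int_iff)
  qed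
  then obtain y where y: "\<forall>i\<in>{1..s}. [y = nat (x i mod m i)] (mod nat (m i))"
    using chinese_remainder_nat[of "{1..s}" "\<lambda>i. nat (m i)" "\<lambda>i. nat (x i mod m i)"] by auto
  have "[int y = x i mod m i] (mod m i)" if "i \<in> {1..s}" for i
  proof -
    have "[int y = int (nat (x i mod m i))] (mod int (nat (m i)))"
      using y that by (simp only: cong_int_iff)
    moreover have "m i > 0" "0 \<le> x i mod m i"
      using that assms(1) by auto
    ultimately show ?thesis by simp
  qed
  then show ?thesis
    by (intro exI[of _ "int y"]) (simp add: crt_solution_def)
qed

section \<open>Uniqueness\<close>

lemma valid_rational_unique:
  assumes moduli: "strict_mono_on {1..s} m" "\<forall>i\<in>{1..s}. m i \<ge> 2"
    "pairwise (\<lambda>i j. coprime (m i) (m j)) {1..s}" "e \<le> s"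
    and M: "M_total s m > 2 * P * Q * (M_max s m e)\<^sup>2"
    and X: "crt_solution s m x X"
    and r: "valid_rational s m e P Q x r" and r': "valid_rational s m e P Q x r'"
  shows "r = r'"
proof -
  obtain p q d where 1: "quotient_of r = (p, q)" "\<bar>p\<bar> \<le> P" "1 \<le> q" "q \<le> Q"
    "1 \<le> d" "d \<le> M_max s m e" "M_total s m dvd d * (q * X - p)"
    using valid_rational_lift[OF moduli X r] by blast
  obtain p' q' d' where 2: "quotient_of r' = (p', q')" "\<bar>p'\<bar> \<le> P" "1 \<le> q'" "q' \<le> Q"
    "1 \<le> d'" "d' \<le> M_max s m e" "M_total s m dvd d' * (q' * X - p')"
    using valid_rational_lift[OF moduli X r'] by blast
  have "M_total s m dvd d * q * (d' * (q' * X - p')) - d' * q' * (d * (q * X - p))"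
    by (rule dvd_diff[OF dvd_mult[OF 2(7)] dvd_mult[OF 1(7)]])
  also have "d * q * (d' * (q' * X - p')) - d' * q' * (d * (q * X - p))
      = (d * d') * (p * q' - p' * q)"
    by (simp add: algebra_simps)
  finally have dvd: "M_total s m dvd (d * d') * (p * q' - p' * q)" .
  have "\<bar>p * q'\<bar> \<le> P * Q" "\<bar>p' * q\<bar> \<le> P * Q"
    unfolding abs_mult using 1 2 by (auto intro!: mult_mono)
  then have "\<bar>p * q' - p' * q\<bar> \<le> 2 * P * Q" by linarith
  moreover have "d * d' \<le> (M_max s m e)\<^sup>2"
    unfolding power2_eq_square using 1 2 by (intro mult_mono) auto
  ultimately have "(d * d') * \<bar>p * q' - p' * q\<bar> \<le> (M_max s m e)\<^sup>2 * (2 * P * Q)"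
    using 1 2 by (intro mult_mono) auto
  with M have "\<bar>(d * d') * (p * q' - p' * q)\<bar> < M_total s m"
    using 1 2 by (simp add: abs_mult mult.commute mult.left_commute)
  then have "(d * d') * (p * q' - p' * q) = 0"
    using dvd_imp_le_int[OF _ dvd] by linarith
  then have "p * q' = p' * q"
    using 1 2 by auto
  then have "(of_int p * of_int q' :: rat) = of_int p' * of_int q"
    by (metis of_int_mult)
  then show ?thesis
    using 1 2 quotient_of_div[OF 1(1)] quotient_of_div[OF 2(1)] by (simp add: frac_eq_eq)
qed

section \<open>The Euclidean loop\<close>

text \<open>
  The last condition is what makes the division \<open>u1 / u2\<close> safe: once the loop has stopped, with
  \<open>\<bar>v2\<bar> > B\<close>, it gives \<open>u2 \<noteq> 0\<close>.
\<close>

definition euclid_inv ::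
  "int \<Rightarrow> int \<Rightarrow> int \<Rightarrow> int \<times> int \<times> int \<Rightarrow> int \<times> int \<times> int \<Rightarrow> bool" where
  "euclid_inv M X B u v \<longleftrightarrow>
     (case u of (u1, u2, u3) \<Rightarrow> case v of (v1, v2, v3) \<Rightarrow>
        u3 = u1 * M + u2 * X \<and> v3 = v1 * M + v2 * X \<and> 0 < u3 \<and> 0 \<le> v3 \<and>
        gcd u3 v3 = gcd X M \<and> \<bar>u2 * v3 - v2 * u3\<bar> = M \<and> u2 * v2 \<le> 0 \<and>
        \<bar>u2\<bar> \<le> B \<and> (u2 = 0 \<longrightarrow> \<bar>v2\<bar> \<le> B))"

lemma euclid_inv_init:
  assumes "M > 0" "X \<ge> 0" "B \<ge> 1"
  shows "euclid_inv M X B (1, 0, M) (0, 1, X)"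
  using assms by (simp add: euclid_inv_def gcd.commute)

lemma abs_diff_opposite_signs:
  fixes u v a b :: int
  assumes "u * v \<le> 0" "a \<ge> 0" "b \<ge> 0"
  shows "\<bar>u * a - v * b\<bar> = \<bar>u\<bar> * a + \<bar>v\<bar> * b"
proof (cases "u \<ge> 0 \<and> v \<le> 0")
  case True
  then have "u * a \<ge> 0" "v * b \<le> 0"
    using assms by (auto simp: mult_nonpos_nonneg)
  with True show ?thesis by simp
next
  case False
  then have "u \<le> 0" "v \<ge> 0"
    using assms(1) by (auto simp: mult_le_0_iff)
  moreover from this have "u * a \<le> 0" "v * b \<ge> 0"
    using assms by (auto simp: mult_nonpos_nonneg)
  ultimately show ?thesis by simp
qed

lemma euclid_inv_cofactors:
  assumes "euclid_inv M X B (u1, u2, u3) (v1, v2, v3)"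
  shows "\<bar>u2\<bar> * v3 + \<bar>v2\<bar> * u3 = M"
  using assms abs_diff_opposite_signs[of u2 v2 v3 u3] by (auto simp only: euclid_inv_def prod.case)

lemma euclid_inv_step:
  assumes inv: "euclid_inv M X B (u1, u2, u3) (v1, v2, v3)"
    and "\<bar>v2\<bar> \<le> B" "v3 \<noteq> 0"
  defines "q \<equiv> u3 div v3"
  shows "euclid_inv M X B (v1, v2, v3) (u1 - q * v1, u2 - q * v2, u3 - q * v3)"
proof -
  have v3: "v3 > 0" and "u3 > 0"
    using inv assms(3) by (auto simp: euclid_inv_def)
  then have q: "q \<ge> 0"
    by (simp add: q_def pos_imp_zdiv_nonneg_iff)
  have rem: "u3 - q * v3 = u3 mod v3"
    by (simp add: q_def minus_div_mult_eq_mod)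
  have "gcd u3 v3 = gcd X M"
    using inv unfolding euclid_inv_def by blast
  then have "gcd v3 (u3 - q * v3) = gcd X M"
    unfolding rem by (simp only: gcd_red_int[of u3])
  moreover have "u3 - q * v3 \<ge> 0"
    unfolding rem using v3 by simp
  moreover have "v2 * (u3 - q * v3) - (u2 - q * v2) * v3 = - (u2 * v3 - v2 * u3)"
    by (simp add: algebra_simps)
  moreover have "v2 * (u2 - q * v2) \<le> 0"
  proof -
    have "v2 * (u2 - q * v2) = u2 * v2 - q * (v2 * v2)"
      by (simp add: algebra_simps)
    moreover have "q * (v2 * v2) \<ge> 0"
      using q by simp
    ultimately show ?thesis
      using inv by (simp add: euclid_inv_def)
  qed
  moreover have "u3 - q * v3 = (u1 - q * v1) * M + (u2 - q * v2) * X"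
    using inv by (simp add: euclid_inv_def algebra_simps)
  ultimately show ?thesis
    using inv assms(2) v3 unfolding euclid_inv_def by (auto simp: abs_minus_commute)
qed

lemma ftrr_loop_terminates:
  assumes "euclid_inv M X B (u1, u2, u3) (v1, v2, v3)"
    and small: "B * gcd X M < M"
  shows "\<exists>a1 a2 a3 b1 b2 b3. ftrr_loop B (u1, u2, u3) (v1, v2, v3) = Some (a1, a2, a3) \<and>
    euclid_inv M X B (a1, a2, a3) (b1, b2, b3) \<and> \<bar>b2\<bar> > B"
  using assms(1)
proof (induction "nat v3" arbitrary: u1 u2 u3 v1 v2 v3 rule: less_induct)
  case less
  show ?case
  proof (cases "\<bar>v2\<bar> \<le> B")
    case False
    then show ?thesis
      using less.prems
      by (intro exI[of _ u1] exI[of _ u2] exI[of _ u3] exI[of _ v1] exI[of _ v2] exI[of _ v3])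
        (simp add: ftrr_loop.simps)
  next
    case True
    \<comment> \<open>At \<open>v3 = 0\<close> the remainder \<open>u3\<close> is the gcd, and \<open>\<bar>v2\<bar> u3 = M\<close>.\<close>
    have nz: "v3 \<noteq> 0"
    proof
      assume "v3 = 0"
      then have "u3 = gcd X M" "\<bar>v2\<bar> * u3 = M"
        using less.prems euclid_inv_cofactors[OF less.prems] by (auto simp: euclid_inv_def)
      then show False
        using mult_right_mono[OF True, of "gcd X M"] small by simp
    qed
    define q where "q = u3 div v3"
    have "v3 > 0"
      using less.prems nz by (auto simp: euclid_inv_def)
    then have "nat (u3 - q * v3) < nat v3"
      by (simp add: q_def minus_div_mult_eq_mod)
    moreover have "euclid_inv M X B (v1, v2, v3) (u1 - q * v1, u2 - q * v2, u3 - q * v3)"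
      using euclid_inv_step[OF less.prems True nz] by (simp add: q_def)
    moreover have "ftrr_loop B (u1, u2, u3) (v1, v2, v3)
        = ftrr_loop B (v1, v2, v3) (u1 - q * v1, u2 - q * v2, u3 - q * v3)"
      using True nz by (subst ftrr_loop.simps) (simp add: q_def Let_def)
    ultimately show ?thesis
      using less.hyps by metis
  qed
qed

text \<open>
  The rows \<open>(u2, u3)\<close> and \<open>(v2, v3)\<close> generate the lattice of all \<open>(b, a)\<close> with \<open>b X \<equiv> a\<close> modulo
  \<open>M\<close>, so \<open>(b, a)\<close> is an integer combination of them. Suppose that the second row occurs in it.
  As \<open>\<bar>b\<bar> < \<bar>v2\<bar>\<close>, there must be cancellation in the first coordinate, and since \<open>u2\<close> and \<open>v2\<close> have
  opposite signs, there is none in the second one. Hence \<open>\<bar>a\<bar> \<ge> u3\<close>, and this makes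
  \<open>\<bar>b u3 - a u2\<bar>\<close> less than \<open>M\<close>. But \<open>M\<close> divides that number, so it is zero.
\<close>

lemma convergent_unique:
  fixes a b A B M X :: int
  assumes inv: "euclid_inv M X B (u1, u2, u3) (v1, v2, v3)" and exit: "\<bar>v2\<bar> > B"
    and b: "\<bar>b\<bar> \<le> B" and a: "\<bar>a\<bar> \<le> A"
    and cong: "M dvd b * X - a" and small: "2 * A * B < M"
  shows "b * u3 = a * u2"
proof (rule ccontr)
  assume neq: "b * u3 \<noteq> a * u2"
  have u3: "u3 = u1 * M + u2 * X" and v3: "v3 = v1 * M + v2 * X"
    and pos: "u3 > 0" "v3 \<ge> 0" and det: "\<bar>u2 * v3 - v2 * u3\<bar> = M"
    and sgn: "u2 * v2 \<le> 0" and u2: "\<bar>u2\<bar> \<le> B"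
    using inv by (auto simp: euclid_inv_def)
  have "b * u3 - a * u2 = u2 * (b * X - a) + b * u1 * M"
    "b * v3 - a * v2 = v2 * (b * X - a) + b * v1 * M"
    by (auto simp: u3 v3 algebra_simps)
  then have "M dvd b * u3 - a * u2" "M dvd b * v3 - a * v2"
    using cong by auto
  then obtain c d where c: "b * u3 - a * u2 = M * c" and d: "b * v3 - a * v2 = M * d"
    by (auto elim!: dvdE)
  have c0: "c \<noteq> 0" using neq c by auto
  have M0: "M > 0"
  proof -
    have "0 \<le> A * B" using a b by (intro mult_nonneg_nonneg) linarith+
    then show ?thesis using small by simp
  qed
  \<comment> \<open>Cramer's rule: up to a common sign, \<open>d\<close> and \<open>- c\<close> are the coordinates of \<open>(b, a)\<close>.\<close>
  have "M * (d * u2 - c * v2) = (M * d) * u2 - (M * c) * v2"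
    "M * (d * u3 - c * v3) = (M * d) * u3 - (M * c) * v3"
    by (simp_all add: algebra_simps)
  then have "M * (d * u2 - c * v2) = b * (u2 * v3 - v2 * u3)"
    "M * (d * u3 - c * v3) = a * (u2 * v3 - v2 * u3)"
    unfolding c[symmetric] d[symmetric] by (simp_all add: algebra_simps)
  then have "\<bar>M * (d * u2 - c * v2)\<bar> = \<bar>b\<bar> * M" "\<bar>M * (d * u3 - c * v3)\<bar> = \<bar>a\<bar> * M"
    by (simp_all add: abs_mult det)
  then have "M * \<bar>d * u2 - c * v2\<bar> = M * \<bar>b\<bar>" "M * \<bar>d * u3 - c * v3\<bar> = M * \<bar>a\<bar>"
    using M0 by (simp_all add: abs_mult mult.commute)
  then have babs: "\<bar>d * u2 - c * v2\<bar> = \<bar>b\<bar>" and aabs: "\<bar>d * u3 - c * v3\<bar> = \<bar>a\<bar>"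
    using M0 by auto
  have "c * d < 0"
  proof (rule ccontr)
    assume "\<not> c * d < 0"
    then have "(d * u2) * (c * v2) \<le> 0"
      using sgn mult_nonneg_nonpos[of "c * d" "u2 * v2"] by (simp add: ac_simps)
    then have "\<bar>d * u2 - c * v2\<bar> = \<bar>d * u2\<bar> + \<bar>c * v2\<bar>"
      using abs_diff_opposite_signs[of "d * u2" "c * v2" 1 1] by simp
    moreover have "\<bar>v2\<bar> \<le> \<bar>c * v2\<bar>"
      using c0 mult_right_mono[of 1 "\<bar>c\<bar>" "\<bar>v2\<bar>"] by (simp add: abs_mult)
    ultimately show False
      using babs b exit by linarith
  qed
  then have "\<bar>a\<bar> = \<bar>d\<bar> * u3 + \<bar>c\<bar> * v3" "d \<noteq> 0"
    using abs_diff_opposite_signs[of d c u3 v3] pos aabs by (auto simp: mult.commute)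
  moreover have "u3 \<le> \<bar>d\<bar> * u3" "0 \<le> \<bar>c\<bar> * v3"
    using pos \<open>d \<noteq> 0\<close> mult_right_mono[of 1 "\<bar>d\<bar>" u3] by auto
  ultimately have "u3 \<le> A" using a by linarith
  then have "\<bar>b\<bar> * u3 \<le> A * B" "\<bar>a\<bar> * \<bar>u2\<bar> \<le> A * B"
    using a b u2 pos mult_mono[of "\<bar>b\<bar>" B u3 A] by (auto intro!: mult_mono simp: mult.commute)
  then have "\<bar>b * u3 - a * u2\<bar> \<le> 2 * A * B"
    using pos abs_triangle_ineq4[of "b * u3" "a * u2"] by (simp add: abs_mult)
  also have "\<dots> < M" by (rule small)
  finally have "\<bar>M * c\<bar> < M" using c by simp
  then show False
    using M0 c0 by (simp add: abs_mult)
qed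

section \<open>Correctness of a run\<close>

lemma valid_rational_zero_iff:
  assumes "P > 0" "Q > 0" "e \<le> s"
  shows "valid_rational s m e P Q x 0 \<longleftrightarrow> s - e \<le> card {i \<in> {1..s}. [x i = 0] (mod m i)}"
proof -
  have good: "good m x 0 i \<longleftrightarrow> [x i = 0] (mod m i)" for i
    by (simp add: good_def)
  have "{i \<in> {1..s}. \<not> good m x 0 i} = {1..s} - {i \<in> {1..s}. good m x 0 i}"
    by blast
  then have "card {i \<in> {1..s}. \<not> good m x 0 i} = card ({1..s} - {i \<in> {1..s}. good m x 0 i})"
    by (rule arg_cong)
  also have "\<dots> = s - card {i \<in> {1..s}. good m x 0 i}"
    by (subst card_Diff_subset) auto
  finally have "card {i \<in> {1..s}. \<not> good m x 0 i} = s - card {i \<in> {1..s}. good m x 0 i}" .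
  then show ?thesis
    using assms by (auto simp: valid_rational_def good)
qed

lemma ftrr_run_correct:
  assumes moduli: "strict_mono_on {1..s} m" "\<forall>i\<in>{1..s}. m i \<ge> 2"
    "pairwise (\<lambda>i j. coprime (m i) (m j)) {1..s}" "e \<le> s"
    and PQ: "P > 0" "Q > 0"
    and M_large: "M_total s m > 2 * P * Q * (M_max s m e)\<^sup>2"
    and X: "crt_solution s m x X"
  shows "\<exists>res. ftrr_run s m e P Q x X = Some res \<and>
    (case res of Return r \<Rightarrow> valid_rational s m e P Q x r
     | Failure \<Rightarrow> (\<nexists>r. valid_rational s m e P Q x r))"
proof (cases "s - e \<le> card {i \<in> {1..s}. [x i = 0] (mod m i)}")
  case True
  then show ?thesis
    using valid_rational_zero_iff[OF PQ \<open>e \<le> s\<close>] by (simp add: ftrr_run_def)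
next
  case False
  define M where "M = M_total s m"
  define A where "A = P * M_max s m e"
  define B where "B = Q * M_max s m e"
  have "M_max s m e \<ge> 1"
    unfolding M_max_def
  proof (rule prod_ge_1)
    fix i assume "i \<in> {s - e + 1..s}"
    then have "2 \<le> m i" using moduli(2) by simp
    then show "1 \<le> m i" by simp
  qed
  then have AB: "A \<ge> 1" "B \<ge> 1"
    using PQ mult_mono[of 1 P 1 "M_max s m e"] mult_mono[of 1 Q 1 "M_max s m e"]
    by (auto simp: A_def B_def)
  have small: "2 * A * B < M"
    using M_large by (simp add: M_def A_def B_def power2_eq_square ac_simps)
  have lift: "\<exists>a b. a \<noteq> 0 \<and> \<bar>a\<bar> \<le> A \<and> 1 \<le> b \<and> b \<le> B \<and> M dvd b * X - a \<and> r = of_int a / of_int b"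
    if r: "valid_rational s m e P Q x r" for r
  proof -
    obtain p q d where *: "quotient_of r = (p, q)" "\<bar>p\<bar> \<le> P" "1 \<le> q" "q \<le> Q"
      "1 \<le> d" "d \<le> M_max s m e" "M_total s m dvd d * (q * X - p)"
      using valid_rational_lift[OF moduli X r] by blast
    have rpq: "r = of_int p / of_int q"
      using *(1) by (rule quotient_of_div)
    have "r \<noteq> 0"
      using r False valid_rational_zero_iff[OF PQ \<open>e \<le> s\<close>] by auto
    then have "d * p \<noteq> 0"
      using rpq * by auto
    moreover have "\<bar>d * p\<bar> \<le> A"
      using * mult_mono[of "\<bar>p\<bar>" P d "M_max s m e"] PQ by (simp add: A_def abs_mult mult.commute)
    moreover have "1 \<le> d * q"
      using * mult_mono[of 1 d 1 q] by simp
    moreover have "d * q \<le> B"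
      using * mult_mono[of q Q d "M_max s m e"] by (simp add: B_def mult.commute)
    moreover have "M dvd (d * q) * X - d * p"
      using *(7) by (simp add: M_def algebra_simps)
    moreover have "r = of_int (d * p) / of_int (d * q)"
      using rpq * by simp
    ultimately show ?thesis by blast
  qed
  show ?thesis
  proof (cases "gcd X M > A")
    case True
    have "\<not> valid_rational s m e P Q x r" for r
    proof
      assume "valid_rational s m e P Q x r"
      then obtain a b where a: "a \<noteq> 0" "\<bar>a\<bar> \<le> A" and dvd: "M dvd b * X - a"
        using lift by blast
      have "gcd X M dvd b * X - (b * X - a)"
        by (rule dvd_diff[OF dvd_mult[OF gcd_dvd1] dvd_trans[OF gcd_dvd2 dvd]])
      then have "gcd X M \<le> \<bar>a\<bar>"
        using a(1) dvd_imp_le_int[of a "gcd X M"] by simp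
      then show False
        using a(2) True by linarith
    qed
    then show ?thesis
      using False True by (simp add: ftrr_run_def M_def A_def Let_def)
  next
    case gcd_le: False
    have "B * gcd X M \<le> B * A"
      using gcd_le AB by (intro mult_left_mono) auto
    also have "\<dots> < M"
    proof -
      have "A * B > 0" using AB by simp
      then show ?thesis using small by (simp add: mult.commute mult.left_commute)
    qed
    finally have gcd_small: "B * gcd X M < M" .
    have "0 \<le> B * gcd X M" using AB by simp
    with gcd_small have "M > 0" by linarith
    moreover have "X \<ge> 0" using X by (simp add: crt_solution_def)
    ultimately obtain u1 u2 u3 v1 v2 v3
      where loop: "ftrr_loop B (1, 0, M) (0, 1, X) = Some (u1, u2, u3)"
        and inv: "euclid_inv M X B (u1, u2, u3) (v1, v2, v3)" and exit: "\<bar>v2\<bar> > B"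
      using ftrr_loop_terminates[OF euclid_inv_init gcd_small] AB by blast
    have u2: "u2 \<noteq> 0" and u3: "u3 = u1 * M + u2 * X"
      using inv exit by (auto simp: euclid_inv_def)
    define r :: rat where "r = of_int X + of_int M * (of_int u1 / of_int u2)"
    have r_eq: "r = of_int u3 / of_int u2"
      using u2 by (simp add: r_def u3 field_simps)
    have run: "ftrr_run s m e P Q x X
        = (if valid_rational s m e P Q x r then Some (Return r) else Some Failure)"
      using False gcd_le loop u2
      by (simp add: ftrr_run_def M_def A_def B_def r_def Let_def)
    have "r' = r" if valid: "valid_rational s m e P Q x r'" for r'
    proof -
      obtain a b where ab: "\<bar>a\<bar> \<le> A" "1 \<le> b" "b \<le> B" "M dvd b * X - a"
        and r': "r' = of_int a / of_int b"
        using lift[OF valid] by blast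
      have "b * u3 = a * u2"
        using ab by (intro convergent_unique[OF inv exit _ _ _ small]) auto
      then have "(of_int b * of_int u3 :: rat) = of_int a * of_int u2"
        by (metis of_int_mult)
      then show ?thesis
        using u2 ab(2) by (simp add: r' r_eq frac_eq_eq mult.commute)
    qed
    then have "\<nexists>r'. valid_rational s m e P Q x r'" if "\<not> valid_rational s m e P Q x r"
      using that by metis
    then show ?thesis
      by (cases "valid_rational s m e P Q x r") (simp_all add: run)
  qed
qed

lemma valid_rational_reduce:
  "valid_rational s m e P Q (\<lambda>i. x i mod m i) r \<longleftrightarrow> valid_rational s m e P Q x r"
  by (simp add: valid_rational_def good_def cong_def mod_mult_right_eq)

theorem mainTheorem3:
  fixes s e :: nat and m x :: "nat \<Rightarrow> int" and P Q :: int
  assumes "strict_mono_on {1..s} m"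
    and "\<forall>i\<in>{1..s}. m i \<ge> 2"
    and "pairwise (\<lambda>i j. coprime (m i) (m j)) {1..s}"
    and "P > 0" and "Q > 0"
    and "e \<le> s"
    and "M_total s m > 2 * P * Q * (M_max s m e)\<^sup>2"
  shows "(\<forall>r r'. valid_rational s m e P Q x r \<and> valid_rational s m e P Q x r' \<longrightarrow> r = r') \<and>
    (\<forall>r. valid_rational s m e P Q x r \<longrightarrow>
       ftrr_terminates_with s m e P Q (\<lambda>i. x i mod m i) (Return r)) \<and>
    ((\<nexists>r. valid_rational s m e P Q x r) \<longrightarrow>
       ftrr_terminates_with s m e P Q (\<lambda>i. x i mod m i) Failure)"
proof -
  let ?x = "\<lambda>i. x i mod m i"
  let ?valid = "valid_rational s m e P Q x"
  note moduli = assms(1-3,6)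
  obtain X0 where X0: "crt_solution s m ?x X0"
    using crt_solution_exists[of s m x] assms(2,3) by force
  have unique: "r = r'" if "?valid r" "?valid r'" for r r'
    using valid_rational_unique[OF moduli assms(7) X0] that by (simp add: valid_rational_reduce)
  have run: "\<exists>res. ftrr_run s m e P Q ?x X = Some res \<and>
      (case res of Return r \<Rightarrow> ?valid r | Failure \<Rightarrow> (\<nexists>r. ?valid r))"
    if "crt_solution s m ?x X" for X
    using ftrr_run_correct[OF moduli assms(4,5,7) that] by (simp only: valid_rational_reduce)
  have "ftrr_run s m e P Q ?x X = Some (Return r)"
    if X: "crt_solution s m ?x X" and r: "?valid r" for X r
  proof -
    obtain res where res: "ftrr_run s m e P Q ?x X = Some res"
      "case res of Return r \<Rightarrow> ?valid r | Failure \<Rightarrow> (\<nexists>r. ?valid r)"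
      using run[OF X] by blast
    show ?thesis
    proof (cases res)
      case Failure
      then show ?thesis using res(2) r by simp
    next
      case (Return r')
      then show ?thesis using res unique[OF _ r] by simp
    qed
  qed
  moreover have "ftrr_run s m e P Q ?x X = Some Failure"
    if X: "crt_solution s m ?x X" and none: "\<nexists>r. ?valid r" for X
  proof -
    obtain res where res: "ftrr_run s m e P Q ?x X = Some res"
      "case res of Return r \<Rightarrow> ?valid r | Failure \<Rightarrow> (\<nexists>r. ?valid r)"
      using run[OF X] by blast
    then show ?thesis
      using none by (cases res) auto
  qed
  ultimately show ?thesis
    using unique X0 unfolding ftrr_terminates_with_def by blast
qed

end
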